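(* Let $X$ be one of the following surfaces: the Euclidean plane $\mathbb{E}^2$, the round sphere $\mathbb{S}^2$ of some radius $r>0$, or the hyperbolic plane $\mathbb{H}^2$ of constant curvature $-1/r^2$ for some $r>0$. Let $ABDC$ be an equiangular quadrilateral in $X$. For a point $A$ and a distance $\rho$, let $O(A,\rho)$ denote the disk in $X$ with center $A$ and radius $\rho$, and let $O_{AB}=O(A,|AB|)$, $O_{AC}=O(A,|AC|)$, $O_{AD}=O(A,|AD|)$, where $|PQ|$ denotes the (intrinsic) distance in $X$ between $P$ and $Q$. Then \[ \operatorname{area}(O_{AB})+\operatorname{area}(O_{AC})=\operatorname{area}(O_{AD}). \]
   Context: Straight lines in $\mathbb{S}^2$ are great circles, and segments (arcs) between two non-antipodal points are the shortest great-circle arcs joining them; in $\mathbb{H}^2$ they are geodesics. A quadrilateral $ABDC$ has vertices in cyclic order $A,B,D,C$, sides the segments $AB$, $BD$, $DC$, $CA$, and diagonals $AD$ and $BC$. It is called equiangular if its four interior angles are all equal; equivalently, the diagonals $AD$ and $BC$ have equal length and intersect each other in their midpoints. A disk with center $A$ and radius $\rho$ is the set of points of $X$ at distance at most $\rho$ from $A$, and area is the Riemannian area on $X$. *)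

theory Defs
  imports "HOL-Analysis.Analysis"
begin

definition metric_midpoint :: "'a set \<Rightarrow> ('a \<Rightarrow> 'a \<Rightarrow> real) \<Rightarrow> 'a \<Rightarrow> 'a \<Rightarrow> 'a \<Rightarrow> bool" where
  "metric_midpoint P d M X Y \<longleftrightarrow> M \<in> P \<and> d X M = d X Y / 2 \<and> d M Y = d X Y / 2"

text \<open>Equiangular quadrilateral ABDC: diagonals AD and BC of equal length meeting in their
  common midpoint (the characterization given in the paper).\<close>
definition equiangular_quad :: "'a set \<Rightarrow> ('a \<Rightarrow> 'a \<Rightarrow> real) \<Rightarrow> 'a \<Rightarrow> 'a \<Rightarrow> 'a \<Rightarrow> 'a \<Rightarrow> bool" where
  "equiangular_quad P d A B D C \<longleftrightarrow> A \<in> P \<and> B \<in> P \<and> D \<in> P \<and> C \<in> P \<and>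
     d A D = d B C \<and> (\<exists>M. metric_midpoint P d M A D \<and> metric_midpoint P d M B C)"

definition gdisk :: "'a set \<Rightarrow> ('a \<Rightarrow> 'a \<Rightarrow> real) \<Rightarrow> 'a \<Rightarrow> real \<Rightarrow> 'a set" where
  "gdisk P d A \<rho> = {x \<in> P. d A x \<le> \<rho>}"

definition euc_area :: "(real^2) set \<Rightarrow> real" where
  "euc_area S = measure lebesgue S"

text \<open>Round sphere of radius r in R^3, great-circle distance, Riemannian area via
  spherical coordinates (area element r^2 sin phi dtheta dphi).\<close>
definition sph_dist :: "real \<Rightarrow> real^3 \<Rightarrow> real^3 \<Rightarrow> real" where
  "sph_dist r x y = r * arccos ((x \<bullet> y) / r\<^sup>2)"

definition sph_param :: "real \<Rightarrow> real \<Rightarrow> real \<Rightarrow> real^3" where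
  "sph_param r \<theta> \<phi> = vector [r * cos \<theta> * sin \<phi>, r * sin \<theta> * sin \<phi>, r * cos \<phi>]"

definition sph_area :: "real \<Rightarrow> (real^3) set \<Rightarrow> real" where
  "sph_area r S = integral (cbox (0, 0) (2 * pi, pi))
     (\<lambda>(\<theta>, \<phi>). indicator S (sph_param r \<theta> \<phi>) * r\<^sup>2 * sin \<phi>)"

text \<open>Hyperbolic plane of curvature -1/r^2: upper half-plane with metric
  r^2 (dx^2+dy^2)/y^2.\<close>
definition hyp_plane :: "complex set" where
  "hyp_plane = {z. Im z > 0}"

definition hyp_dist :: "real \<Rightarrow> complex \<Rightarrow> complex \<Rightarrow> real" where
  "hyp_dist r z w = r * arcosh (1 + (cmod (z - w))\<^sup>2 / (2 * Im z * Im w))"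

definition hyp_area :: "real \<Rightarrow> complex set \<Rightarrow> real" where
  "hyp_area r S = integral S (\<lambda>z. r\<^sup>2 / (Im z)\<^sup>2)"

end

(* In each geometry the midpoint condition is linear in the vector model: A + D = 2 c M and
   B + C = 2 c M with the same c (c = 1, cos or cosh of half the length of a diagonal), so
   A + D = B + C. Pairing with A, for the inner product or the Minkowski form, gives the relation
   between |AB|, |AC| and |AD| that corresponds, via the areas pi rho^2, 2 pi r^2 (1 - cos (rho/r))
   and 2 pi r^2 (cosh (rho/r) - 1) of disks, to the additivity of areas. *)

theory Submission
  imports Defs
begin

text \<open>The linear relation comes from V = A + D - 2 c M, whose self-pairing is forced to be 0
  by the three distances. That gives V = 0 where the form is definite. The Minkowski form is
  indefinite, and there V must also be shown orthogonal to the timelike vector M. Most of the length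
  goes into the areas. \<open>sph_area\<close> and \<open>hyp_area\<close> are integrals in fixed
  coordinates that are not adapted to the centre of the disk, and no invariance under isometries is
  established for them. Disks of arbitrary centre are therefore integrated directly, in slices along
  which the area density is constant: latitude circles on the sphere, horizontal lines in the
  half-plane. The slices are summed as nonnegative integrals, so that Tonelli applies without
  integrability, and turned into \<open>has_integral\<close> statements at the end; this rules out
  the default value of \<open>integral\<close>.\<close>

lemma power2_strict_mono_abs:
  fixes x y :: real
  assumes "\<bar>x\<bar> < y" shows "x\<^sup>2 < y\<^sup>2"
  using power_strict_mono[OF assms, of 2] by simp

section \<open>Euclidean plane\<close>

text \<open>By the parallelogram law for X - M and Y - M, the defect X + Y - 2 M has a squared norm
  that depends only on the three distances, and it vanishes for the halved distances.\<close>

lemma metric_midpoint_dist: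
  fixes X Y :: "'a::real_inner"
  assumes "metric_midpoint UNIV dist M X Y"
  shows "X + Y = 2 *\<^sub>R M"
proof -
  have d: "norm (X - M) = norm (X - Y) / 2" "norm (Y - M) = norm (X - Y) / 2"
    using assms by (auto simp: metric_midpoint_def dist_norm norm_minus_commute)
  have "(norm (X + Y - 2 *\<^sub>R M))\<^sup>2 = 2 * (norm (X - M))\<^sup>2 + 2 * (norm (Y - M))\<^sup>2 - (norm (X - Y))\<^sup>2"
    unfolding power2_norm_eq_inner by (simp add: inner_simps inner_commute algebra_simps)
  also have "\<dots> = 0" unfolding d by (simp add: power_divide)
  finally show ?thesis by simp
qed

text \<open>The parallelogram law equates the sum of the squared diagonals with twice the sum of the
  squared sides at A; equal diagonals turn this into Pythagoras.\<close>

lemma pythagoras_equiangular_quad: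
  fixes A B C D :: "'a::real_inner"
  assumes "equiangular_quad UNIV dist A B D C"
  shows "(dist A B)\<^sup>2 + (dist A C)\<^sup>2 = (dist A D)\<^sup>2"
proof -
  obtain M where "metric_midpoint UNIV dist M A D" "metric_midpoint UNIV dist M B C"
    and diag: "dist A D = dist B C"
    using assms by (auto simp: equiangular_quad_def)
  then have "A + D = B + C" by (simp add: metric_midpoint_dist)
  then have D: "D = B + C - A" by (simp add: algebra_simps)
  have "2 * ((dist A B)\<^sup>2 + (dist A C)\<^sup>2) = (dist A D)\<^sup>2 + (dist B C)\<^sup>2"
    unfolding D dist_norm power2_norm_eq_inner by (simp add: inner_simps inner_commute algebra_simps)
  then show ?thesis using diag by simp
qed

lemma euc_area_disk:
  assumes "\<rho> \<ge> 0"
  shows "euc_area (gdisk UNIV dist A \<rho>) = pi * \<rho>\<^sup>2"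
proof -
  have "gdisk UNIV dist A \<rho> = cball A \<rho>" by (auto simp: gdisk_def)
  then show ?thesis using assms
    by (simp add: euc_area_def content_cball unit_ball_vol_2 measure_completion)
qed

section \<open>Sphere\<close>

text \<open>With c = cos t, where t is half the angle between A and D, the vector A + D - 2 c M has
  squared norm r^2 (2 + 4 c^2 + 2 (2 c^2 - 1) - 8 c^2) = 0 by the double-angle formula.\<close>

lemma sph_midpoint:
  assumes r: "r > 0" and A: "A \<in> sphere 0 r" and D: "D \<in> sphere 0 r"
    and M: "metric_midpoint (sphere 0 r) (sph_dist r) M A D"
  shows "A + D = (2 * cos (sph_dist r A D / (2 * r))) *\<^sub>R M"
proof -
  define t where "t = sph_dist r A D / (2 * r)"
  have [simp]: "norm A = r" "norm D = r" "norm M = r" using A D M by (auto simp: metric_midpoint_def)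
  have dist: "x \<bullet> y = r\<^sup>2 * cos (sph_dist r x y / r)" if "norm x = r" "norm y = r" for x y :: "real^3"
  proof -
    \<comment> \<open>Cauchy-Schwarz keeps the argument of \<open>arccos\<close> in [-1, 1], where
      \<open>cos\<close> inverts it.\<close>
    have "\<bar>x \<bullet> y\<bar> \<le> r\<^sup>2" using Cauchy_Schwarz_ineq2[of x y] that by (simp add: power2_eq_square)
    then have "\<bar>x \<bullet> y / r\<^sup>2\<bar> \<le> 1" using r by (simp add: abs_divide)
    then have "cos (arccos (x \<bullet> y / r\<^sup>2)) = x \<bullet> y / r\<^sup>2" by (rule cos_arccos_abs)
    then show ?thesis using r by (simp add: sph_dist_def)
  qed
  have "sph_dist r A M / r = t" "sph_dist r M D / r = t" "sph_dist r A D / r = 2 * t"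
    using M r by (auto simp: metric_midpoint_def t_def field_simps)
  then have AM: "A \<bullet> M = r\<^sup>2 * cos t" and MD: "M \<bullet> D = r\<^sup>2 * cos t"
    and AD: "A \<bullet> D = r\<^sup>2 * (2 * (cos t)\<^sup>2 - 1)"
    by (simp_all add: dist cos_double_cos)
  have sq: "A \<bullet> A = r\<^sup>2" "D \<bullet> D = r\<^sup>2" "M \<bullet> M = r\<^sup>2" by (simp_all add: dot_square_norm)
  define V where "V = A + D - (2 * cos t) *\<^sub>R M"
  have "V \<bullet> V = A \<bullet> A + D \<bullet> D + 4 * (cos t)\<^sup>2 * (M \<bullet> M) + 2 * (A \<bullet> D) - 4 * cos t * (A \<bullet> M) - 4 * cos t * (M \<bullet> D)"
    unfolding V_def by (simp add: inner_simps inner_commute power2_eq_square algebra_simps)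
  also have "\<dots> = 0" unfolding sq AM MD AD by (simp add: power2_eq_square algebra_simps)
  finally show ?thesis by (simp add: V_def t_def)
qed

lemma sph_inner_equiangular_quad:
  assumes r: "r > 0" and Q: "equiangular_quad (sphere 0 r) (sph_dist r) A B D C"
  shows "A \<bullet> B + A \<bullet> C = r\<^sup>2 + A \<bullet> D"
proof -
  obtain M where M: "metric_midpoint (sphere 0 r) (sph_dist r) M A D"
      "metric_midpoint (sphere 0 r) (sph_dist r) M B C"
    and P: "A \<in> sphere 0 r" "B \<in> sphere 0 r" "D \<in> sphere 0 r" "C \<in> sphere 0 r"
    and diag: "sph_dist r A D = sph_dist r B C"
    using Q by (auto simp: equiangular_quad_def)
  have "B + C = A + D"
    using sph_midpoint[OF r P(1,3) M(1)] sph_midpoint[OF r P(2,4) M(2)] diag by simp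
  then have "A \<bullet> (B + C) = A \<bullet> (A + D)" by simp
  then show ?thesis using P(1) by (simp add: inner_add_right dot_square_norm)
qed

section \<open>Integrals of the arcsine density\<close>

text \<open>The junk-free version of 1 / sqrt q: Isabelle's square root is odd, so 1 / sqrt q
  does not vanish for negative q.\<close>

definition arcsine_density :: "real \<Rightarrow> real" where
  "arcsine_density q = (if q > 0 then 1 / sqrt q else 0)"

lemma arcsine_density_measurable [measurable]: "arcsine_density \<in> borel_measurable borel"
  unfolding arcsine_density_def by measurable

lemma arcsine_density_nonneg: "0 \<le> arcsine_density q"
  by (simp add: arcsine_density_def)

text \<open>An antiderivative is arcsin ((x - m) / w). The clamp to [-1, 1] covers a bound c outside
  the support [m - w, m + w] of the density.\<close>

lemma nn_integral_arcsine_density: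
  fixes c m w :: real
  assumes w: "0 < w"
  shows "(\<integral>\<^sup>+x\<in>{c..}. ennreal (arcsine_density (w\<^sup>2 - (x - m)\<^sup>2)) \<partial>lborel)
       = ennreal (arccos (max (-1) (min 1 ((c - m) / w))))"
proof (cases "c \<le> m + w")
  case False
  have "ennreal (arcsine_density (w\<^sup>2 - (x - m)\<^sup>2)) * indicator {c..} x = (0 :: ennreal)" for x
  proof (cases "c \<le> x")
    case True
    then have "w \<le> x - m" using False by linarith
    then have "w\<^sup>2 \<le> (x - m)\<^sup>2" using w by (intro power_mono) auto
    then show ?thesis by (simp add: arcsine_density_def)
  qed simp
  then have "(\<integral>\<^sup>+x\<in>{c..}. ennreal (arcsine_density (w\<^sup>2 - (x - m)\<^sup>2)) \<partial>lborel) = 0"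
    by (simp only: nn_integral_const mult_zero_left)
  moreover have "1 \<le> (c - m) / w" using False w by (simp add: field_simps)
  ultimately show ?thesis by simp
next
  case True
  define l where "l = max c (m - w)"
  have l: "m - w \<le> l" "l \<le> m + w" using True w by (auto simp: l_def)
  \<comment> \<open>The density is unbounded near m - w and m + w, where arcsin is only continuous;
    the version of the fundamental theorem that differentiates in the interior alone is
    enough.\<close>
  have "((\<lambda>x. arcsine_density (w\<^sup>2 - (x - m)\<^sup>2)) has_integral
      arcsin ((m + w - m) / w) - arcsin ((l - m) / w)) {l..m + w}"
  proof (rule fundamental_theorem_of_calculus_interior)
    show "continuous_on {l..m + w} (\<lambda>x. arcsin ((x - m) / w))"
      using l w by (intro continuous_intros) (auto simp: field_simps)
    fix x assume x: "x \<in> {l<..<m + w}"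
    then have *: "\<bar>x - m\<bar> < w" using l by auto
    then have q: "(x - m)\<^sup>2 < w\<^sup>2" by (rule power2_strict_mono_abs)
    have eq: "sqrt (1 - ((x - m) / w)\<^sup>2) = sqrt (w\<^sup>2 - (x - m)\<^sup>2) / w"
    proof -
      have "1 - ((x - m) / w)\<^sup>2 = (w\<^sup>2 - (x - m)\<^sup>2) / w\<^sup>2" using w by (simp add: field_simps power_divide)
      then show ?thesis using w by (simp add: real_sqrt_divide)
    qed
    have b: "-1 < (x - m) / w" "(x - m) / w < 1" using * w by (auto simp: field_simps)
    have "((\<lambda>x. arcsin ((x - m) / w)) has_real_derivative
        inverse (sqrt (1 - ((x - m) / w)\<^sup>2)) * (1 / w)) (at x)"
      using b w by (auto intro!: derivative_eq_intros)
    then show "((\<lambda>x. arcsin ((x - m) / w)) has_vector_derivative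
        arcsine_density (w\<^sup>2 - (x - m)\<^sup>2)) (at x)"
      using w q unfolding eq by (simp add: has_real_derivative_iff_has_vector_derivative arcsine_density_def field_simps)
  qed (use l in auto)
  then have "(\<integral>\<^sup>+x. indicator {l..m + w} x * arcsine_density (w\<^sup>2 - (x - m)\<^sup>2) \<partial>lborel)
     = ennreal (arcsin ((m + w - m) / w) - arcsin ((l - m) / w))"
    by (intro nn_integral_has_integral_lebesgue) (auto simp: arcsine_density_nonneg)
  moreover have "(\<integral>\<^sup>+x\<in>{c..}. ennreal (arcsine_density (w\<^sup>2 - (x - m)\<^sup>2)) \<partial>lborel)
     = (\<integral>\<^sup>+x. indicator {l..m + w} x * arcsine_density (w\<^sup>2 - (x - m)\<^sup>2) \<partial>lborel)"
  proof (intro nn_integral_cong)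
    fix x :: real
    have "arcsine_density (w\<^sup>2 - (x - m)\<^sup>2) = 0" if "\<not> (m - w \<le> x \<and> x \<le> m + w)"
    proof -
      have "\<bar>w\<bar> \<le> \<bar>x - m\<bar>" using that w by auto
      then show ?thesis by (simp add: arcsine_density_def abs_le_square_iff)
    qed
    then show "ennreal (arcsine_density (w\<^sup>2 - (x - m)\<^sup>2)) * indicator {c..} x =
       ennreal (indicator {l..m + w} x * arcsine_density (w\<^sup>2 - (x - m)\<^sup>2))"
      by (auto simp: indicator_def l_def)
  qed
  moreover have "arcsin ((m + w - m) / w) - arcsin ((l - m) / w) = arccos (max (-1) (min 1 ((c - m) / w)))"
  proof -
    have "(l - m) / w = max (-1) (min 1 ((c - m) / w))" using w True
      by (auto simp: l_def max_def min_def field_simps)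
    moreover have "-1 \<le> (l - m) / w" "(l - m) / w \<le> 1" using l w by (auto simp: field_simps)
    ultimately show ?thesis using w by (simp add: arccos_arcsin_eq)
  qed
  ultimately show ?thesis by simp
qed

text \<open>Half the length of the set of angles t in a period with c \<le> p cos t + q.\<close>

definition cap_half_angle :: "real \<Rightarrow> real \<Rightarrow> real \<Rightarrow> real" where
  "cap_half_angle p q c = (if p = 0 then (if c \<le> q then pi else 0)
     else arccos (max (- 1) (min 1 ((c - q) / p))))"

text \<open>The total mass depends on neither m nor w; this is why the area of a cap will not depend
  on where its centre lies.\<close>

lemma nn_integral_arcsine_density_UNIV:
  assumes w: "0 < w"
  shows "(\<integral>\<^sup>+x. ennreal (arcsine_density (w\<^sup>2 - (x - m)\<^sup>2)) \<partial>lborel) = ennreal pi"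
proof -
  have "arcsine_density (w\<^sup>2 - (x - m)\<^sup>2) = 0" if "x < m - w" for x
  proof -
    have "\<bar>w\<bar> \<le> \<bar>x - m\<bar>" using that w by auto
    then show ?thesis by (simp add: arcsine_density_def abs_le_square_iff)
  qed
  then have "(\<integral>\<^sup>+x. ennreal (arcsine_density (w\<^sup>2 - (x - m)\<^sup>2)) \<partial>lborel)
      = (\<integral>\<^sup>+x\<in>{m - w..}. ennreal (arcsine_density (w\<^sup>2 - (x - m)\<^sup>2)) \<partial>lborel)"
    by (intro nn_integral_cong) (auto simp: indicator_def not_le)
  then show ?thesis using w by (simp add: nn_integral_arcsine_density)
qed

section \<open>Angular length of the part of a latitude circle inside a cap\<close>

lemma nn_integral_periodic:
  fixes f :: "real \<Rightarrow> ennreal" and T :: real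
  assumes [measurable]: "f \<in> borel_measurable borel"
    and per: "\<And>x. f (x + T) = f x" and ab: "a \<le> b" "b \<le> a + T"
  shows "(\<integral>\<^sup>+x\<in>{b..<b + T}. f x \<partial>lborel) = (\<integral>\<^sup>+x\<in>{a..<a + T}. f x \<partial>lborel)"
proof -
  \<comment> \<open>The window is cut at a + T and the overhang is translated back by one period;
    half-open intervals make the pieces exactly disjoint.\<close>
  have "(\<integral>\<^sup>+x\<in>{b..<b + T}. f x \<partial>lborel)
      = (\<integral>\<^sup>+x. f x * indicator {b..<a + T} x + f x * indicator {a + T..<b + T} x \<partial>lborel)"
    using ab by (intro nn_integral_cong) (auto simp: indicator_def)
  also have "\<dots> = (\<integral>\<^sup>+x\<in>{b..<a + T}. f x \<partial>lborel) + (\<integral>\<^sup>+x\<in>{a + T..<b + T}. f x \<partial>lborel)"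
    by (intro nn_integral_add) auto
  also have "(\<integral>\<^sup>+x\<in>{a + T..<b + T}. f x \<partial>lborel) = (\<integral>\<^sup>+x\<in>{a..<b}. f x \<partial>lborel)"
    by (subst nn_integral_real_affine[where c = 1 and t = T])
      (auto intro!: nn_integral_cong simp: indicator_def per add.commute[of T])
  also have "(\<integral>\<^sup>+x\<in>{b..<a + T}. f x \<partial>lborel) + (\<integral>\<^sup>+x\<in>{a..<b}. f x \<partial>lborel)
      = (\<integral>\<^sup>+x. f x * indicator {b..<a + T} x + f x * indicator {a..<b} x \<partial>lborel)"
    by (intro nn_integral_add[symmetric]) auto
  also have "\<dots> = (\<integral>\<^sup>+x\<in>{a..<a + T}. f x \<partial>lborel)"
    using ab by (intro nn_integral_cong) (auto simp: indicator_def)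
  finally show ?thesis .
qed

text \<open>The cosine is even and decreasing on [0, pi], so the set is a symmetric interval with
  half-length the arccos of the clamped bound.\<close>

lemma nn_integral_cos_ge:
  fixes u :: real
  shows "(\<integral>\<^sup>+x\<in>{- pi..<pi}. indicator {x. u \<le> cos x} x \<partial>lborel) = ennreal (2 * arccos (max (- 1) (min 1 u)))"
proof -
  define v where "v = max (- 1) (min 1 u)"
  have v: "\<bar>v\<bar> \<le> 1" by (auto simp: v_def)
  have L: "0 \<le> arccos v" "arccos v \<le> pi" using v by (auto intro!: arccos_lbound arccos_ubound)
  have iff: "v \<le> cos x \<longleftrightarrow> \<bar>x\<bar> \<le> arccos v" if "\<bar>x\<bar> \<le> pi" for x
  proof -
    have "v \<le> cos x \<longleftrightarrow> cos (arccos v) \<le> cos \<bar>x\<bar>" using v by (simp add: cos_arccos_abs)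
    also have "\<dots> \<longleftrightarrow> \<bar>x\<bar> \<le> arccos v" using that L by (intro cos_mono_le_eq) auto
    finally show ?thesis .
  qed
  show ?thesis
  \<comment> \<open>Clamping preserves the condition only for u \<le> 1. For larger u the set is
    empty, and the formula agrees because arccos 1 = 0.\<close>
  proof (cases "u \<le> 1")
    case True
    then have uv: "u \<le> cos x \<longleftrightarrow> v \<le> cos x" for x by (auto simp: v_def)
    \<comment> \<open>The half-open window misses pi, which belongs to the closed interval when
      arccos v = pi.\<close>
    have "AE x in lborel. x \<noteq> pi" by (rule AE_lborel_singleton)
    then have "(\<integral>\<^sup>+x\<in>{- pi..<pi}. indicator {x. u \<le> cos x} x \<partial>lborel)
        = (\<integral>\<^sup>+x. indicator {- arccos v..arccos v} x \<partial>lborel)"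
    proof (intro nn_integral_cong_AE, eventually_elim)
      fix x :: real assume "x \<noteq> pi"
      then show "indicator {x. u \<le> cos x} x * indicator {- pi..<pi} x
          = (indicator {- arccos v..arccos v} x :: ennreal)"
        using L iff[of x] by (auto simp: indicator_def uv abs_le_iff)
    qed
    also have "\<dots> = ennreal (2 * arccos v)" using L by simp
    finally show ?thesis by (simp add: v_def)
  next
    case False
    then have "\<not> u \<le> cos x" for x using cos_le_one[of x] by linarith
    then show ?thesis using False by simp
  qed
qed

lemma nn_integral_cos_shift_ge:
  fixes p q c \<theta>0 :: real
  assumes "\<bar>\<theta>0\<bar> \<le> pi" "p \<ge> 0"
  shows "(\<integral>\<^sup>+\<theta>\<in>{0..2 * pi}. indicator {\<theta>. c \<le> p * cos (\<theta> - \<theta>0) + q} \<theta> \<partial>lborel)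
    = ennreal (2 * cap_half_angle p q c)"
proof (cases "p = 0")
  case True
  then show ?thesis by (simp add: cap_half_angle_def)
next
  case False
  define u where "u = (c - q) / p"
  have iff: "c \<le> p * cos x + q \<longleftrightarrow> u \<le> cos x" for x
    using False assms by (simp add: u_def field_simps)
  have "AE \<theta> in lborel. \<theta> \<noteq> 2 * pi" by (rule AE_lborel_singleton)
  then have "(\<integral>\<^sup>+\<theta>\<in>{0..2 * pi}. indicator {\<theta>. c \<le> p * cos (\<theta> - \<theta>0) + q} \<theta> \<partial>lborel)
      = (\<integral>\<^sup>+\<theta>\<in>{0..<2 * pi}. indicator {\<theta>. u \<le> cos (\<theta> - \<theta>0)} \<theta> \<partial>lborel)"
    unfolding iff by (intro nn_integral_cong_AE, eventually_elim) (auto simp: indicator_def)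
  also have "\<dots> = (\<integral>\<^sup>+x\<in>{- \<theta>0..<- \<theta>0 + 2 * pi}. indicator {x. u \<le> cos x} x \<partial>lborel)"
    by (subst nn_integral_real_affine[where c = 1 and t = \<theta>0])
      (auto intro!: nn_integral_cong simp: indicator_def)
  \<comment> \<open>The bound on \<theta>0 places the start of the window in [-pi, pi], so it
    exceeds -pi by at most one period.\<close>
  also have "\<dots> = (\<integral>\<^sup>+x\<in>{- pi..<- pi + 2 * pi}. indicator {x. u \<le> cos x} x \<partial>lborel)"
    using assms by (intro nn_integral_periodic) (auto simp: indicator_def)
  also have "\<dots> = ennreal (2 * cap_half_angle p q c)"
    using nn_integral_cos_ge[of u] False by (simp add: cap_half_angle_def u_def)
  finally show ?thesis .
qed

section \<open>Integration over the heights z = cos \<phi>\<close>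

lemma nn_integral_cos_substitution:
  fixes h :: "real \<Rightarrow> real"
  assumes [measurable]: "h \<in> borel_measurable borel"
  shows "(\<integral>\<^sup>+\<phi>\<in>{0..pi}. ennreal (h (cos \<phi>) * sin \<phi>) \<partial>lborel) = (\<integral>\<^sup>+z\<in>{-1..1}. ennreal (h z) \<partial>lborel)"
proof -
  \<comment> \<open>Since cos decreases on [0, pi], the substitution uses the increasing function
    -cos and is followed by a reflection.\<close>
  have "(\<integral>\<^sup>+\<phi>\<in>{0..pi}. ennreal (h (cos \<phi>) * sin \<phi>) \<partial>lborel)
      = (\<integral>\<^sup>+x. ennreal (h (- x) * indicator {- cos 0..- cos pi} x) \<partial>lborel)"
    by (subst nn_integral_substitution[where g = "\<lambda>x. - cos x" and g' = sin and f = "\<lambda>x. h (- x)"])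
      (auto intro!: nn_integral_cong derivative_eq_intros continuous_intros sin_ge_zero
        simp: set_borel_measurable_def indicator_def)
  also have "\<dots> = (\<integral>\<^sup>+z\<in>{-1..1}. ennreal (h z) \<partial>lborel)"
    by (subst nn_integral_real_affine[where c = "-1" and t = 0])
      (auto intro!: nn_integral_cong simp: indicator_def)
  finally show ?thesis .
qed

lemma cap_half_angle_measurable [measurable]:
  assumes [measurable]: "p \<in> borel_measurable borel" "q \<in> borel_measurable borel"
  shows "(\<lambda>z::real. cap_half_angle (p z) (q z) c) \<in> borel_measurable borel"
proof -
  have "continuous_on UNIV (\<lambda>v::real. arccos (max (- 1) (min 1 v)))"
    by (intro continuous_intros) auto
  then have [measurable]: "(\<lambda>v::real. arccos (max (- 1) (min 1 v))) \<in> borel_measurable borel"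
    by (rule borel_measurable_continuous_onI)
  show ?thesis unfolding cap_half_angle_def by measurable
qed

lemma cap_half_angle_nonneg: "0 \<le> cap_half_angle p q c"
  by (auto simp: cap_half_angle_def intro!: arccos_lbound)

text \<open>The arccos is written as an integral of the density 1 / sqrt (Q x z) over x \<ge> c. Since
  Q is symmetric in x and z, exchanging the integrals leaves an inner integral over z
  with the value pi for every x in (-1, 1).\<close>

lemma nn_integral_cap_half_angle:
  fixes a s c :: real
  assumes as: "a\<^sup>2 + s\<^sup>2 = 1" and s: "s \<ge> 0" and c: "\<bar>c\<bar> \<le> 1"
  shows "(\<integral>\<^sup>+z\<in>{-1..1}. ennreal (cap_half_angle (s * sqrt (1 - z\<^sup>2)) (a * z) c) \<partial>lborel) = ennreal (pi * (1 - c))"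
proof (cases "s = 0")
  case True
  then have a: "a = 1 \<or> a = -1" using as by (simp add: power2_eq_1_iff)
  \<comment> \<open>The centre of the cap is a pole here: each latitude circle lies entirely inside
    or entirely outside, and \<open>I\<close> collects the heights of those inside.\<close>
  define I where "I = (if a = 1 then {c..1} else {-1..-c})"
  have "(\<integral>\<^sup>+z\<in>{-1..1}. ennreal (cap_half_angle (s * sqrt (1 - z\<^sup>2)) (a * z) c) \<partial>lborel)
     = (\<integral>\<^sup>+z. ennreal pi * indicator I z \<partial>lborel)"
    using True a c by (intro nn_integral_cong) (auto simp: cap_half_angle_def I_def indicator_def)
  also have "\<dots> = ennreal pi * emeasure lborel I"
    by (intro nn_integral_cmult_indicator) (auto simp: I_def)
  also have "emeasure lborel I = ennreal (1 - c)" using c by (auto simp: I_def)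
  finally show ?thesis using c by (simp add: ennreal_mult)
next
  case False
  then have s: "s > 0" using s by simp
  \<comment> \<open>This is w^2 - (x - m)^2 for w = s sqrt (1 - z^2) and m = a z, expanded with a^2
    + s^2 = 1. Geometrically it is the Gram determinant of three unit vectors (pole, centre, point
    of the sphere) with pairwise inner products a, x, z, whence the symmetry.\<close>
  define Q where "Q = (\<lambda>x z. s\<^sup>2 - z\<^sup>2 - x\<^sup>2 + 2 * a * x * z)"
  have a2: "a\<^sup>2 = 1 - s\<^sup>2" using as by simp
  have Q: "Q x z = (s * sqrt (1 - z\<^sup>2))\<^sup>2 - (x - a * z)\<^sup>2" if "\<bar>z\<bar> \<le> 1" for x z
  proof -
    have "z\<^sup>2 \<le> 1" using that by (simp add: abs_square_le_1)
    then have "(s * sqrt (1 - z\<^sup>2))\<^sup>2 - (x - a * z)\<^sup>2 = s\<^sup>2 * (1 - z\<^sup>2) - x\<^sup>2 + 2 * a * x * z - a\<^sup>2 * z\<^sup>2"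
      by (simp add: power_mult_distrib power2_diff algebra_simps)
    also have "\<dots> = Q x z" unfolding a2 Q_def by (simp add: algebra_simps)
    finally show ?thesis by simp
  qed
  \<comment> \<open>Outside (-1, 1) the density vanishes, so both integrals can run over whole lines
    and be exchanged freely.\<close>
  have Qneg: "Q x z \<le> 0" if "\<bar>z\<bar> \<ge> 1" for x z
  proof -
    have "z\<^sup>2 \<ge> 1" using that by (metis abs_1 abs_le_square_iff one_power2)
    then have "s\<^sup>2 * (1 - z\<^sup>2) \<le> 0" by (simp add: mult_le_0_iff)
    moreover have "Q x z = s\<^sup>2 * (1 - z\<^sup>2) - (x - a * z)\<^sup>2"
      unfolding Q_def power2_diff power_mult_distrib a2 by (simp add: algebra_simps)
    ultimately show ?thesis using zero_le_power2[of "x - a * z"] by linarith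
  qed
  have Q_sym: "Q x z = Q z x" for x z by (simp add: Q_def)
  have w: "s * sqrt (1 - z\<^sup>2) > 0" if "\<bar>z\<bar> < 1" for z
    using that s by (simp add: abs_square_less_1)
  have "(\<integral>\<^sup>+z\<in>{-1..1}. ennreal (cap_half_angle (s * sqrt (1 - z\<^sup>2)) (a * z) c) \<partial>lborel)
      = (\<integral>\<^sup>+z. (\<integral>\<^sup>+x\<in>{c..}. ennreal (arcsine_density (Q x z)) \<partial>lborel) \<partial>lborel)"
  proof (intro nn_integral_cong_AE)
    \<comment> \<open>At the poles w = 0: \<open>cap_half_angle\<close> may be pi there while the
      density is identically 0. Two points are negligible.\<close>
    have "AE z in lborel. z \<noteq> (1::real)" "AE z in lborel. z \<noteq> (-1::real)" by (rule AE_lborel_singleton)+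
    then show "AE z in lborel. ennreal (cap_half_angle (s * sqrt (1 - z\<^sup>2)) (a * z) c) * indicator {-1..1} z
      = (\<integral>\<^sup>+x\<in>{c..}. ennreal (arcsine_density (Q x z)) \<partial>lborel)"
    proof eventually_elim
      fix z :: real assume z: "z \<noteq> 1" "z \<noteq> -1"
      show "ennreal (cap_half_angle (s * sqrt (1 - z\<^sup>2)) (a * z) c) * indicator {-1..1} z
      = (\<integral>\<^sup>+x\<in>{c..}. ennreal (arcsine_density (Q x z)) \<partial>lborel)"
      proof (cases "\<bar>z\<bar> < 1")
        case True
        have "cap_half_angle (s * sqrt (1 - z\<^sup>2)) (a * z) c
            = arccos (max (- 1) (min 1 ((c - a * z) / (s * sqrt (1 - z\<^sup>2)))))"
          unfolding cap_half_angle_def using w[OF True] by (intro if_not_P) linarith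
        moreover have "indicator {-1..1} z = (1 :: ennreal)" using True by (simp add: abs_less_iff)
        ultimately show ?thesis
          using nn_integral_arcsine_density[OF w[OF True], where c = c and m = "a * z"]
          by (simp only: Q[OF less_imp_le[OF True]] mult_1_right)
      next
        case False
        then have "arcsine_density (Q x z) = 0" for x
          using Qneg[of z x] by (simp add: arcsine_density_def not_less)
        moreover have "z \<notin> {-1..1}" using False z by auto
        ultimately show ?thesis by simp
      qed
    qed
  qed
  also have "\<dots> = (\<integral>\<^sup>+x. (\<integral>\<^sup>+z. ennreal (arcsine_density (Q x z)) * indicator {c..} x \<partial>lborel) \<partial>lborel)"
    unfolding Q_def by (intro lborel_pair.Fubini') measurable
  also have "\<dots> = (\<integral>\<^sup>+x. ennreal pi * indicator {c..1} x \<partial>lborel)"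
  proof (intro nn_integral_cong_AE)
    have "AE x in lborel. x \<noteq> (1::real)" "AE x in lborel. x \<noteq> (-1::real)" by (rule AE_lborel_singleton)+
    then show "AE x in lborel. (\<integral>\<^sup>+z. ennreal (arcsine_density (Q x z)) * indicator {c..} x \<partial>lborel)
        = ennreal pi * indicator {c..1} x"
    proof eventually_elim
      fix x :: real assume x: "x \<noteq> 1" "x \<noteq> -1"
      show "(\<integral>\<^sup>+z. ennreal (arcsine_density (Q x z)) * indicator {c..} x \<partial>lborel)
        = ennreal pi * indicator {c..1} x"
      proof (cases "\<bar>x\<bar> < 1")
        case True
        then have "(\<integral>\<^sup>+z. ennreal (arcsine_density (Q x z)) \<partial>lborel) = ennreal pi"
          unfolding Q_sym[of x] using nn_integral_arcsine_density_UNIV[OF w[OF True], of "a * x"] by (simp add: Q)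
        then show ?thesis using True by (auto simp: indicator_def)
      next
        case False
        then have "arcsine_density (Q x z) = 0" for z
          using Qneg[of x z] unfolding Q_sym[of x] by (simp add: arcsine_density_def not_less)
        then show ?thesis using False x c by (auto simp: indicator_def)
      qed
    qed
  qed
  also have "\<dots> = ennreal (pi * (1 - c))"
    using c by (subst nn_integral_cmult_indicator) (simp_all add: ennreal_mult)
  finally show ?thesis .
qed

text \<open>The axis of the coordinates is fixed while A is arbitrary, so the cap is cut along
  latitude circles. Each contributes twice a \<open>cap_half_angle\<close>, the factor sin \<phi> is
  the Jacobian of z = cos \<phi>, and \<open>nn_integral_cap_half_angle\<close> supplies an integral
  over z that no longer sees a or s.\<close>

lemma sph_area_cap:
  fixes A :: "real^3"
  assumes r: "r > 0" and A: "norm A = r" and c: "\<bar>c\<bar> \<le> 1"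
  shows "sph_area r {x \<in> sphere 0 r. c * r\<^sup>2 \<le> A \<bullet> x} = 2 * pi * r\<^sup>2 * (1 - c)"
proof -
  define S where "S = {x \<in> sphere 0 r. c * r\<^sup>2 \<le> A \<bullet> x}"
  define a where "a = A $ 3 / r"
  define s where "s = sqrt ((A $ 1)\<^sup>2 + (A $ 2)\<^sup>2) / r"
  have norm: "(A $ 1)\<^sup>2 + (A $ 2)\<^sup>2 + (A $ 3)\<^sup>2 = r\<^sup>2"
    using dot_square_norm[of A] unfolding A by (simp add: inner_vec_def sum_3 power2_eq_square)
  have s: "s \<ge> 0" using r by (simp add: s_def)
  have as: "a\<^sup>2 + s\<^sup>2 = 1"
    using r norm by (simp add: a_def s_def power_divide add_divide_distrib[symmetric] add_ac)
  \<comment> \<open>(s, a) and \<theta>0 are the spherical coordinates of A, so r^2 (s sin \<phi> cos (\<theta> - \<theta>0) + a cos \<phi>)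
    is its inner product with the point of coordinates \<theta>, \<phi>.\<close>
  obtain \<theta>0 where \<theta>0: "\<bar>\<theta>0\<bar> \<le> pi" and A12: "A $ 1 = r * s * cos \<theta>0" "A $ 2 = r * s * sin \<theta>0"
  proof (cases "s = 0")
    case True
    then have "A $ 1 = 0" "A $ 2 = 0" using r by (auto simp: s_def sum_power2_eq_zero_iff)
    then show ?thesis using True by (intro that[of 0]) auto
  next
    case False
    have rs: "(r * s)\<^sup>2 = (A $ 1)\<^sup>2 + (A $ 2)\<^sup>2" using r by (simp add: s_def)
    \<comment> \<open>\<open>sincos_total_2pi\<close> yields an angle in [0, 2 pi). Applied to the
      opposite direction and shifted by -pi, it gives the angle of A in [-pi, pi).\<close>
    have "(- (A $ 1 / (r * s)))\<^sup>2 + (- (A $ 2 / (r * s)))\<^sup>2 = 1"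
      using False r unfolding power2_minus power_divide rs[symmetric]
      by (simp only: add_divide_distrib[symmetric] rs[symmetric]) simp
    then obtain t where t: "0 \<le> t" "t < 2 * pi" "- (A $ 1 / (r * s)) = cos t" "- (A $ 2 / (r * s)) = sin t"
      by (rule sincos_total_2pi)
    have "A $ 1 = r * s * cos (t - pi)" "A $ 2 = r * s * sin (t - pi)"
      using False r by (simp_all add: cos_diff sin_diff t(3,4)[symmetric])
    then show ?thesis using t by (intro that[of "t - pi"]) auto
  qed
  have mem: "sph_param r \<theta> \<phi> \<in> S \<longleftrightarrow> c \<le> s * sin \<phi> * cos (\<theta> - \<theta>0) + a * cos \<phi>" for \<theta> \<phi>
  proof -
    have "sph_param r \<theta> \<phi> \<bullet> sph_param r \<theta> \<phi>
        = (r * cos \<theta> * sin \<phi>)\<^sup>2 + (r * sin \<theta> * sin \<phi>)\<^sup>2 + (r * cos \<phi>)\<^sup>2"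
      by (simp add: sph_param_def inner_vec_def sum_3 power2_eq_square)
    also have "\<dots> = r\<^sup>2 * ((sin \<phi>)\<^sup>2 * ((cos \<theta>)\<^sup>2 + (sin \<theta>)\<^sup>2) + (cos \<phi>)\<^sup>2)"
      by algebra
    finally have "norm (sph_param r \<theta> \<phi>) = r" using r by (simp add: norm_eq_sqrt_inner)
    moreover have "A \<bullet> sph_param r \<theta> \<phi> = r\<^sup>2 * (s * sin \<phi> * cos (\<theta> - \<theta>0) + a * cos \<phi>)"
      using r by (simp add: sph_param_def inner_vec_def sum_3 A12 a_def cos_diff power2_eq_square algebra_simps)
    ultimately show ?thesis using r by (simp add: S_def mult.commute[of c])
  qed
  \<comment> \<open>The coordinate box is built into \<open>f\<close>, so that the iterated
    integrals range over the whole plane.\<close>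
  define f where "f = (\<lambda>(\<theta>, \<phi>). if 0 \<le> \<theta> \<and> \<theta> \<le> 2 * pi \<and> 0 \<le> \<phi> \<and> \<phi> \<le> pi \<and>
      c \<le> s * sin \<phi> * cos (\<theta> - \<theta>0) + a * cos \<phi> then r\<^sup>2 * sin \<phi> else 0)"
  have "f \<in> borel_measurable (borel \<Otimes>\<^sub>M borel)"
    unfolding f_def split_beta by measurable
  then have f_borel [measurable]: "f \<in> borel_measurable borel"
    by (simp only: borel_prod)
  have f_nonneg: "0 \<le> f x" for x
    by (cases x) (auto simp: f_def intro!: mult_nonneg_nonneg sin_ge_zero)
  have inner: "(\<integral>\<^sup>+\<theta>. ennreal (f (\<theta>, \<phi>)) \<partial>lborel)
     = ennreal (2 * r\<^sup>2) * (ennreal (cap_half_angle (s * sqrt (1 - (cos \<phi>)\<^sup>2)) (a * cos \<phi>) c * sin \<phi>) * indicator {0..pi} \<phi>)" for \<phi>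
  proof (cases "\<phi> \<in> {0..pi}")
    case True
    then have sin: "sin \<phi> \<ge> 0" by (auto intro: sin_ge_zero)
    have sq: "sqrt (1 - (cos \<phi>)\<^sup>2) = sin \<phi>" using sin by (simp add: sin_squared_eq[symmetric])
    have "(\<integral>\<^sup>+\<theta>. ennreal (f (\<theta>, \<phi>)) \<partial>lborel)
       = (\<integral>\<^sup>+\<theta>. ennreal (r\<^sup>2 * sin \<phi>) * (indicator {\<theta>. c \<le> (s * sin \<phi>) * cos (\<theta> - \<theta>0) + a * cos \<phi>} \<theta> * indicator {0..2 * pi} \<theta>) \<partial>lborel)"
      using True by (intro nn_integral_cong) (auto simp: f_def indicator_def)
    also have "\<dots> = ennreal (r\<^sup>2 * sin \<phi>) * ennreal (2 * cap_half_angle (s * sin \<phi>) (a * cos \<phi>) c)"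
      using \<theta>0 s sin by (subst nn_integral_cmult) (simp_all add: nn_integral_cos_shift_ge)
    also have "\<dots> = ennreal (2 * r\<^sup>2) * ennreal (cap_half_angle (s * sin \<phi>) (a * cos \<phi>) c * sin \<phi>)"
      using sin cap_half_angle_nonneg[of "s * sin \<phi>" "a * cos \<phi>" c]
      by (simp add: ennreal_mult[symmetric] mult_ac)
    finally show ?thesis using True unfolding sq by simp
  next
    case False
    then have "f (\<theta>, \<phi>) = 0" for \<theta> by (auto simp: f_def)
    then show ?thesis using False by simp
  qed
  have "(\<integral>\<^sup>+x. ennreal (f x) \<partial>lborel) = (\<integral>\<^sup>+\<phi>. (\<integral>\<^sup>+\<theta>. ennreal (f (\<theta>, \<phi>)) \<partial>lborel) \<partial>lborel)"
    unfolding lborel_prod[symmetric]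
    by (rule lborel_pair.nn_integral_snd[symmetric]) (simp add: lborel_prod)
  also have "\<dots> = ennreal (2 * r\<^sup>2) * ennreal (pi * (1 - c))"
    unfolding inner
    by (subst nn_integral_cmult)
      (simp_all add: nn_integral_cos_substitution[where h = "\<lambda>z. cap_half_angle (s * sqrt (1 - z\<^sup>2)) (a * z) c"]
        nn_integral_cap_half_angle[OF as s c])
  also have "\<dots> = ennreal (2 * pi * r\<^sup>2 * (1 - c))"
    using c by (simp add: ennreal_mult[symmetric] mult_ac)
  finally have "(f has_integral 2 * pi * r\<^sup>2 * (1 - c)) UNIV"
    using c f_nonneg by (intro nn_integral_has_integral) auto
  moreover have "f = (\<lambda>x. if x \<in> cbox (0, 0) (2 * pi, pi)
      then (\<lambda>(\<theta>, \<phi>). indicator S (sph_param r \<theta> \<phi>) * r\<^sup>2 * sin \<phi>) x else 0)"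
    by (auto simp: f_def fun_eq_iff mem indicator_def)
  ultimately have "((\<lambda>(\<theta>, \<phi>). indicator S (sph_param r \<theta> \<phi>) * r\<^sup>2 * sin \<phi>) has_integral 2 * pi * r\<^sup>2 * (1 - c))
      (cbox (0, 0) (2 * pi, pi))"
    by (simp only: has_integral_restrict_UNIV)
  then show ?thesis unfolding sph_area_def S_def[symmetric] by (rule integral_unique)
qed

text \<open>Since arccos is decreasing, the disk is the cap whose c is the cosine of its angular
  radius.\<close>

lemma sph_area_disk:
  assumes r: "r > 0" and A: "A \<in> sphere 0 r" and B: "B \<in> sphere 0 r"
  shows "sph_area r (gdisk (sphere 0 r) (sph_dist r) A (sph_dist r A B)) = 2 * pi * (r\<^sup>2 - A \<bullet> B)"
proof -
  have bound: "\<bar>A \<bullet> x / r\<^sup>2\<bar> \<le> 1" if "x \<in> sphere 0 r" for x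
  proof -
    have "\<bar>A \<bullet> x\<bar> \<le> r\<^sup>2" using Cauchy_Schwarz_ineq2[of A x] that A by (simp add: power2_eq_square)
    then show ?thesis using r by (simp add: abs_divide)
  qed
  have "sph_dist r A x \<le> sph_dist r A B \<longleftrightarrow> A \<bullet> B / r\<^sup>2 * r\<^sup>2 \<le> A \<bullet> x" if "x \<in> sphere 0 r" for x
    using r arccos_le_mono[OF bound[OF that] bound[OF B]] by (simp add: sph_dist_def divide_le_cancel)
  then have "gdisk (sphere 0 r) (sph_dist r) A (sph_dist r A B)
      = {x \<in> sphere 0 r. A \<bullet> B / r\<^sup>2 * r\<^sup>2 \<le> A \<bullet> x}"
    unfolding gdisk_def by blast
  moreover have "norm A = r" using A by simp
  moreover have "2 * pi * r\<^sup>2 * (1 - A \<bullet> B / r\<^sup>2) = 2 * pi * (r\<^sup>2 - A \<bullet> B)"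
    using r by (simp add: right_diff_distrib)
  ultimately show ?thesis
    using sph_area_cap[OF r _ bound[OF B]] by (simp only:)
qed

section \<open>Hyperbolic plane\<close>

text \<open>For the Minkowski form v1 v3 - v2^2, the orthogonal complement of a timelike vector is
  negative definite, so a null vector in it is zero. This replaces the positive definiteness used on
  the sphere.\<close>

lemma minkowski_null_orthogonal_eq_0:
  fixes v1 v2 v3 m1 m2 m3 :: real
  assumes null: "v1 * v3 = v2\<^sup>2" and orth: "v1 * m3 + v3 * m1 = 2 * (v2 * m2)"
    and timelike: "m1 * m3 = 1 + m2\<^sup>2"
  shows "v1 = 0" "v2 = 0" "v3 = 0"
proof -
  \<comment> \<open>On the complement of m this sum of two squares equals -m3^2 (v1 v3 - v2^2),
    which is the definiteness in explicit form.\<close>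
  have "(v2 * m3 - v3 * m2)\<^sup>2 + v3\<^sup>2 = m3\<^sup>2 * v2\<^sup>2 - m3 * v3 * (2 * (v2 * m2)) + v3\<^sup>2 * (1 + m2\<^sup>2)"
    by (simp add: power2_eq_square algebra_simps)
  also have "\<dots> = 0"
    unfolding null[symmetric] orth[symmetric] timelike[symmetric]
    by (simp add: power2_eq_square algebra_simps)
  finally have z: "v2 * m3 - v3 * m2 = 0" "v3 = 0"
    by (auto simp: sum_power2_eq_zero_iff)
  have "m3 \<noteq> 0"
  proof
    assume "m3 = 0"
    then show False using timelike zero_le_power2[of m2] by simp
  qed
  then show "v2 = 0" "v3 = 0" "v1 = 0" using z orth by auto
qed

text \<open>The hyperboloid model: a point z of the half-plane becomes the vector (u, v, w) with
  u w - v^2 = 1, and the Minkowski form of two such vectors is the hyperbolic cosine of the distance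
  (for r = 1).\<close>

definition hyp_u :: "complex \<Rightarrow> real" where "hyp_u z = (cmod z)\<^sup>2 / Im z"
definition hyp_v :: "complex \<Rightarrow> real" where "hyp_v z = Re z / Im z"
definition hyp_w :: "complex \<Rightarrow> real" where "hyp_w z = 1 / Im z"
definition hyp_form :: "complex \<Rightarrow> complex \<Rightarrow> real" where
  "hyp_form z w = (hyp_u z * hyp_w w + hyp_w z * hyp_u w) / 2 - hyp_v z * hyp_v w"

lemma hyp_form_eq:
  assumes "Im z > 0" "Im w > 0"
  shows "hyp_form z w = 1 + (cmod (z - w))\<^sup>2 / (2 * Im z * Im w)"
  using assms unfolding hyp_form_def hyp_u_def hyp_v_def hyp_w_def cmod_power2
  by (simp add: field_simps power2_eq_square)

lemma hyp_uw:
  assumes "Im z > 0" shows "hyp_u z * hyp_w z = 1 + (hyp_v z)\<^sup>2"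
  using assms unfolding hyp_u_def hyp_v_def hyp_w_def cmod_power2
  by (simp add: field_simps power2_eq_square)

text \<open>As on the sphere with cosh for cos, the defect v has self-pairing 2 + 4 c^2 + 2 (2 c^2 -
  1) - 8 c^2 = 0. Its pairing with M is c + c - 2 c = 0, and the two facts together force it to
  vanish.\<close>

lemma hyp_midpoint:
  assumes r: "r > 0" and A: "A \<in> hyp_plane" and D: "D \<in> hyp_plane"
    and M: "metric_midpoint hyp_plane (hyp_dist r) M A D"
  defines "c \<equiv> cosh (hyp_dist r A D / (2 * r))"
  shows "hyp_u A + hyp_u D = 2 * c * hyp_u M" "hyp_v A + hyp_v D = 2 * c * hyp_v M"
    "hyp_w A + hyp_w D = 2 * c * hyp_w M"
proof -
  have pos: "Im A > 0" "Im D > 0" "Im M > 0" using A D M by (auto simp: hyp_plane_def metric_midpoint_def)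
  have dist: "cosh (hyp_dist r z w / r) = hyp_form z w" if "Im z > 0" "Im w > 0" for z w
    using r that by (simp add: hyp_dist_def hyp_form_eq cosh_arcosh_real)
  define t where "t = hyp_dist r A D / (2 * r)"
  have "hyp_dist r A M / r = t" "hyp_dist r M D / r = t" "hyp_dist r A D / r = 2 * t"
    using M r by (auto simp: metric_midpoint_def t_def field_simps)
  then have AM: "hyp_form A M = c" and MD: "hyp_form M D = c" and AD: "hyp_form A D = 2 * c\<^sup>2 - 1"
    using dist[of A M] dist[of M D] dist[of A D] pos by (auto simp: c_def t_def[symmetric] cosh_double_cosh)
  define v1 where "v1 = hyp_u A + hyp_u D - 2 * c * hyp_u M"
  define v2 where "v2 = hyp_v A + hyp_v D - 2 * c * hyp_v M"
  define v3 where "v3 = hyp_w A + hyp_w D - 2 * c * hyp_w M"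
  note norms = pos[THEN hyp_uw]
  have "v1 * v3 - v2\<^sup>2 = (hyp_u A * hyp_w A - (hyp_v A)\<^sup>2) + (hyp_u D * hyp_w D - (hyp_v D)\<^sup>2)
      + 4 * c\<^sup>2 * (hyp_u M * hyp_w M - (hyp_v M)\<^sup>2)
      + 2 * hyp_form A D - 4 * c * hyp_form A M - 4 * c * hyp_form M D"
    unfolding v1_def v2_def v3_def hyp_form_def by (simp add: power2_eq_square field_simps)
  also have "\<dots> = 0" unfolding norms AM MD AD by (simp add: power2_eq_square algebra_simps)
  finally have 1: "v1 * v3 = v2\<^sup>2" by simp
  have "v1 * hyp_w M + v3 * hyp_u M - 2 * (v2 * hyp_v M)
      = 2 * hyp_form A M + 2 * hyp_form M D - 4 * c * (hyp_u M * hyp_w M - (hyp_v M)\<^sup>2)"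
    unfolding v1_def v2_def v3_def hyp_form_def by (simp add: power2_eq_square field_simps)
  also have "\<dots> = 0" unfolding norms AM MD by simp
  finally have 2: "v1 * hyp_w M + v3 * hyp_u M = 2 * (v2 * hyp_v M)" by simp
  from minkowski_null_orthogonal_eq_0[OF 1 2 norms(3)]
  show "hyp_u A + hyp_u D = 2 * c * hyp_u M" "hyp_v A + hyp_v D = 2 * c * hyp_v M"
    "hyp_w A + hyp_w D = 2 * c * hyp_w M"
    by (auto simp: v1_def v2_def v3_def)
qed

lemma hyp_form_equiangular_quad:
  assumes r: "r > 0" and Q: "equiangular_quad hyp_plane (hyp_dist r) A B D C"
  shows "hyp_form A B + hyp_form A C = 1 + hyp_form A D"
proof -
  obtain M where M: "metric_midpoint hyp_plane (hyp_dist r) M A D"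
      "metric_midpoint hyp_plane (hyp_dist r) M B C"
    and P: "A \<in> hyp_plane" "B \<in> hyp_plane" "D \<in> hyp_plane" "C \<in> hyp_plane"
    and diag: "hyp_dist r A D = hyp_dist r B C"
    using Q by (auto simp: equiangular_quad_def)
  note e1 = hyp_midpoint[OF r P(1,3) M(1)] and e2 = hyp_midpoint[OF r P(2,4) M(2)]
  have e: "hyp_u B + hyp_u C = hyp_u A + hyp_u D" "hyp_v B + hyp_v C = hyp_v A + hyp_v D"
    "hyp_w B + hyp_w C = hyp_w A + hyp_w D"
    unfolding e1 e2 diag by simp_all
  have "hyp_form A B + hyp_form A C
      = (hyp_u A * (hyp_w B + hyp_w C) + hyp_w A * (hyp_u B + hyp_u C)) / 2 - hyp_v A * (hyp_v B + hyp_v C)"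
    unfolding hyp_form_def by (simp add: algebra_simps add_divide_distrib)
  also have "\<dots> = hyp_u A * hyp_w A - (hyp_v A)\<^sup>2 + hyp_form A D"
    unfolding e hyp_form_def by (simp add: algebra_simps add_divide_distrib power2_eq_square)
  finally show ?thesis using hyp_uw[of A] P by (simp add: hyp_plane_def)
qed

section \<open>Area of a hyperbolic disk\<close>

text \<open>A hyperbolic disk around a point of height 1 meets the horocycle at height w in a segment of
  Euclidean length 2 sqrt (2 k w - w^2 - 1), where k is the hyperbolic cosine of its radius.\<close>

lemma has_integral_horocyclic_width:
  fixes k :: real
  assumes k: "1 < k"
  defines "s \<equiv> sqrt (k\<^sup>2 - 1)"
  shows "((\<lambda>w. 2 * sqrt (2 * k * w - w\<^sup>2 - 1) / w\<^sup>2) has_integral 2 * pi * (k - 1)) {k - s..k + s}"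
proof -
  have k2: "k\<^sup>2 > 1" using k by (simp add: one_less_power)
  have s: "s > 0" "s\<^sup>2 = k\<^sup>2 - 1" using k2 by (auto simp: s_def)
  have sk: "s < k" using s(2) k by (intro power2_less_imp_less[of s k]) linarith+
  \<comment> \<open>With R = 2 k w - w^2 - 1, integration by parts turns 2 sqrt R / w^2 into -2 sqrt
    R / w plus the integral of 2 k / (w sqrt R) - 2 / sqrt R. The two ways \<open>q\<close> and
    \<open>q'\<close> of writing R as a difference of squares integrate these terms to the two
    arcsines.\<close>
  define G where "G = (\<lambda>w. - 2 * sqrt (2 * k * w - w\<^sup>2 - 1) / w - 2 * arcsin ((w - k) / s)
      + 2 * k * arcsin ((k * w - 1) / (s * w)))"
  have q: "2 * k * w - w\<^sup>2 - 1 = s\<^sup>2 - (w - k)\<^sup>2" for w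
    unfolding s(2) by (simp add: power2_eq_square algebra_simps)
  have q': "2 * k * w - w\<^sup>2 - 1 = (s * w)\<^sup>2 - (k * w - 1)\<^sup>2" for w
    unfolding power_mult_distrib s(2) by (simp add: power2_eq_square algebra_simps)
  have bnd: "\<bar>(w - k) / s\<bar> \<le> 1 \<and> \<bar>(k * w - 1) / (s * w)\<bar> \<le> 1 \<and> w > 0" if "w \<in> {k - s..k + s}" for w
  proof -
    have w: "w > 0" using that sk by auto
    have 1: "\<bar>w - k\<bar> \<le> \<bar>s\<bar>" using that s by auto
    then have "(w - k)\<^sup>2 \<le> s\<^sup>2" by (simp only: abs_le_square_iff)
    then have "(k * w - 1)\<^sup>2 \<le> (s * w)\<^sup>2" using q[of w] q'[of w] by linarith
    then have "\<bar>k * w - 1\<bar> \<le> \<bar>s * w\<bar>" by (simp only: abs_le_square_iff)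
    then show ?thesis using 1 w s(1) by (simp add: abs_divide abs_mult divide_le_eq)
  qed
  have "((\<lambda>w. 2 * sqrt (2 * k * w - w\<^sup>2 - 1) / w\<^sup>2) has_integral G (k + s) - G (k - s)) {k - s..k + s}"
  proof (rule fundamental_theorem_of_calculus_interior)
    show "continuous_on {k - s..k + s} G"
      unfolding G_def
    proof (intro continuous_intros ballI)
      fix w assume "w \<in> {k - s..k + s}"
      note b = bnd[OF this]
      show "w \<noteq> 0" "s \<noteq> 0" "s * w \<noteq> 0" using b s(1) by auto
      show "- 1 \<le> (w - k) / s \<and> (w - k) / s \<le> 1"
        "- 1 \<le> (k * w - 1) / (s * w) \<and> (k * w - 1) / (s * w) \<le> 1"
        using b unfolding abs_le_iff by linarith+
    qed
    fix w assume w: "w \<in> {k - s<..<k + s}"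
    have w0: "w > 0" using w sk by auto
    have 1: "\<bar>w - k\<bar> < \<bar>s\<bar>" using w s by auto
    define r where "r = sqrt (2 * k * w - w\<^sup>2 - 1)"
    have Q: "2 * k * w - w\<^sup>2 - 1 > 0"
      using power2_strict_mono_abs[of "w - k" s] 1 s(1) unfolding q by simp
    then have r: "r > 0" "r\<^sup>2 = 2 * k * w - w\<^sup>2 - 1" by (auto simp: r_def)
    have e1: "sqrt (1 - ((w - k) / s)\<^sup>2) = r / s"
    proof -
      have "1 - ((w - k) / s)\<^sup>2 = (s\<^sup>2 - (w - k)\<^sup>2) / s\<^sup>2" using s(1) by (simp add: field_simps power_divide)
      then show ?thesis using s(1) unfolding r_def q by (simp add: real_sqrt_divide)
    qed
    have e2: "sqrt (1 - ((k * w - 1) / (s * w))\<^sup>2) = r / (s * w)"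
    proof -
      have "1 - ((k * w - 1) / (s * w))\<^sup>2 = ((s * w)\<^sup>2 - (k * w - 1)\<^sup>2) / (s * w)\<^sup>2"
        unfolding power_divide using s(1) w0 by (subst diff_divide_distrib) simp
      then show ?thesis using s(1) w0 unfolding r_def q' by (simp add: real_sqrt_divide)
    qed
    have b1: "-1 < (w - k) / s" "(w - k) / s < 1" using 1 s(1) by (auto simp: field_simps)
    have lt: "(k * w - 1)\<^sup>2 < (s * w)\<^sup>2" using Q unfolding q' by simp
    have "\<bar>k * w - 1\<bar> < s * w"
    proof (rule power2_less_imp_less)
      show "\<bar>k * w - 1\<bar>\<^sup>2 < (s * w)\<^sup>2" using lt by (simp only: power2_abs)
      show "0 \<le> s * w" using s(1) w0 by simp
    qed
    then have b2: "-1 < (k * w - 1) / (s * w)" "(k * w - 1) / (s * w) < 1"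
      using s(1) w0 by (simp_all add: less_divide_eq divide_less_eq)
    have d1: "((\<lambda>w. sqrt (2 * k * w - w\<^sup>2 - 1)) has_real_derivative (k - w) / r) (at w)"
      unfolding r_def using Q by (auto intro!: derivative_eq_intros simp: field_simps)
    have d2: "((\<lambda>w. arcsin ((w - k) / s)) has_real_derivative 1 / r) (at w)"
    proof -
      have "((\<lambda>w. arcsin ((w - k) / s)) has_real_derivative inverse (sqrt (1 - ((w - k) / s)\<^sup>2)) * (1 / s)) (at w)"
        using b1 s(1) by (auto intro!: derivative_eq_intros)
      then show ?thesis unfolding e1 using s(1) by simp
    qed
    have d3: "((\<lambda>w. arcsin ((k * w - 1) / (s * w))) has_real_derivative 1 / (w * r)) (at w)"
    proof -
      have "((\<lambda>w. (k * w - 1) / (s * w)) has_real_derivative 1 / (s * w\<^sup>2)) (at w)"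
        using s(1) w0 by (auto intro!: derivative_eq_intros simp: field_simps power2_eq_square)
      from DERIV_chain2[OF DERIV_arcsin[OF b2] this]
      show ?thesis unfolding e2 using s(1) w0 r by (simp add: field_simps power2_eq_square)
    qed
    have "(G has_real_derivative
        - (2 * (((k - w) / r * w - r * 1) / (w * w))) - 2 * (1 / r) + 2 * k * (1 / (w * r))) (at w)"
    proof -
      have "((\<lambda>w. sqrt (2 * k * w - w\<^sup>2 - 1) / w) has_real_derivative ((k - w) / r * w - r * 1) / (w * w)) (at w)"
        using DERIV_divide[OF d1 DERIV_ident] w0 by (simp add: r_def)
      note DERIV_add[OF DERIV_diff[OF DERIV_minus[OF DERIV_cmult[OF this, of 2]] DERIV_cmult[OF d2, of 2]] DERIV_cmult[OF d3, of "2 * k"]]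
      then show ?thesis by (simp add: G_def)
    qed
    moreover have "- (2 * (((k - w) / r * w - r * 1) / (w * w))) - 2 * (1 / r) + 2 * k * (1 / (w * r)) = 2 * r / w\<^sup>2"
      using w0 r(1) by (simp add: field_simps power2_eq_square)
    ultimately show "(G has_vector_derivative 2 * sqrt (2 * k * w - w\<^sup>2 - 1) / w\<^sup>2) (at w)"
      by (simp add: has_real_derivative_iff_has_vector_derivative r_def)
  qed (use s in auto)
  \<comment> \<open>At both ends the root vanishes and each arcsine is pi/2 or -pi/2, because s^2 =
    k^2 - 1 makes its argument exactly 1 or -1.\<close>
  moreover have "G (k + s) = - pi + k * pi"
  proof -
    have "k * (k + s) - 1 = s * (k + s)" using s(2) by (simp add: power2_eq_square algebra_simps)
    moreover have "s * (k + s) \<noteq> 0" using s(1) k by simp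
    ultimately show ?thesis unfolding G_def q using s(1) by simp
  qed
  moreover have "G (k - s) = pi - k * pi"
  proof -
    have "k * (k - s) - 1 = - (s * (k - s))" using s(2) by (simp add: power2_eq_square algebra_simps)
    moreover have "s * (k - s) \<noteq> 0" using s(1) sk by simp
    ultimately show ?thesis unfolding G_def q using s(1) by simp
  qed
  ultimately show ?thesis by (simp add: algebra_simps)
qed

text \<open>Comparing boxes suffices, and a complex box pulls back to a product of intervals. The
  purpose is to integrate over the half-plane line by line.\<close>

lemma lborel_complex_eq_distr:
  "(lborel :: complex measure) = distr (lborel \<Otimes>\<^sub>M lborel) lborel (\<lambda>p. Complex (fst p) (snd p))"
proof (rule lborel_eqI)
  have [measurable]: "(\<lambda>p. Complex (fst p) (snd p)) \<in> borel_measurable (lborel \<Otimes>\<^sub>M lborel)"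
    unfolding Complex_eq by measurable
  fix l u :: complex
  assume le: "\<And>b. b \<in> Basis \<Longrightarrow> l \<bullet> b \<le> u \<bullet> b"
  have le': "Re l \<le> Re u" "Im l \<le> Im u" using le[of 1] le[of \<i>] by (auto simp: Basis_complex_def)
  have "(\<lambda>p. Complex (fst p) (snd p)) -` box l u \<inter> space (lborel \<Otimes>\<^sub>M lborel)
      = {Re l<..<Re u} \<times> {Im l<..<Im u}"
    by (auto simp: in_box_complex_iff space_pair_measure)
  then have "emeasure (distr (lborel \<Otimes>\<^sub>M lborel) lborel (\<lambda>p. Complex (fst p) (snd p))) (box l u)
      = emeasure (lborel \<Otimes>\<^sub>M lborel) ({Re l<..<Re u} \<times> {Im l<..<Im u})"
    by (subst emeasure_distr) auto
  also have "\<dots> = ennreal (Re u - Re l) * ennreal (Im u - Im l)"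
    using le' by (subst lborel.emeasure_pair_measure_Times) auto
  also have "\<dots> = ennreal (\<Prod>b\<in>Basis. (u - l) \<bullet> b)"
    using le' by (simp add: Basis_complex_def ennreal_mult complex_eq_iff)
  finally show "emeasure (distr (lborel \<Otimes>\<^sub>M lborel) lborel (\<lambda>p. Complex (fst p) (snd p))) (box l u)
      = (\<Prod>b\<in>Basis. (u - l) \<bullet> b)" .
qed simp

lemma nn_integral_complex:
  fixes f :: "complex \<Rightarrow> ennreal"
  assumes [measurable]: "f \<in> borel_measurable borel"
  shows "(\<integral>\<^sup>+z. f z \<partial>lborel) = (\<integral>\<^sup>+y. (\<integral>\<^sup>+x. f (Complex x y) \<partial>lborel) \<partial>lborel)"
proof -
  have [measurable]: "(\<lambda>p. Complex (fst p) (snd p)) \<in> borel_measurable (lborel \<Otimes>\<^sub>M lborel)"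
    unfolding Complex_eq by measurable
  have "(\<integral>\<^sup>+z. f z \<partial>lborel) = (\<integral>\<^sup>+p. f (Complex (fst p) (snd p)) \<partial>(lborel \<Otimes>\<^sub>M lborel))"
    by (subst lborel_complex_eq_distr, subst nn_integral_distr) auto
  also have "\<dots> = (\<integral>\<^sup>+y. (\<integral>\<^sup>+x. f (Complex x y) \<partial>lborel) \<partial>lborel)"
    by (subst lborel_pair.nn_integral_snd[symmetric]) auto
  finally show ?thesis .
qed

lemma hyp_dist_le_iff:
  assumes "r > 0" "Im A > 0" "Im B > 0" "Im z > 0"
  shows "hyp_dist r A z \<le> hyp_dist r A B \<longleftrightarrow>
    1 + (cmod (A - z))\<^sup>2 / (2 * Im A * Im z) \<le> 1 + (cmod (A - B))\<^sup>2 / (2 * Im A * Im B)"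
proof -
  have "0 \<le> (cmod (A - w))\<^sup>2 / (2 * Im A * Im w)" if "Im w > 0" for w
    using assms that by simp
  then have "1 \<le> 1 + (cmod (A - w))\<^sup>2 / (2 * Im A * Im w)" if "Im w > 0" for w
    using that by simp
  note arcosh_less_iff_real[OF this this, OF assms(3,4)]
  then show ?thesis
    using assms(1) unfolding hyp_dist_def by (simp only: mult_less_cancel_left_pos flip: not_less)
qed

text \<open>With k the hyperbolic cosine of the radius divided by r, the disk is the Euclidean disk
  with centre height k y0 and radius s y0. Integrating over horizontal chords and rescaling heights
  by y0 reduces the area to the integral for a centre of height 1.\<close>

lemma hyp_area_disk:
  assumes r: "r > 0" and A: "A \<in> hyp_plane" and B: "B \<in> hyp_plane"
  shows "hyp_area r (gdisk hyp_plane (hyp_dist r) A (hyp_dist r A B))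
    = 2 * pi * r\<^sup>2 * ((cmod (A - B))\<^sup>2 / (2 * Im A * Im B))"
proof -
  define k where "k = 1 + (cmod (A - B))\<^sup>2 / (2 * Im A * Im B)"
  define s where "s = sqrt (k\<^sup>2 - 1)"
  define y0 where "y0 = Im A"
  define x0 where "x0 = Re A"
  define D where "D = gdisk hyp_plane (hyp_dist r) A (hyp_dist r A B)"
  have y0: "y0 > 0" and ImB: "Im B > 0" using A B by (auto simp: hyp_plane_def y0_def)
  have k: "k \<ge> 1" using y0 ImB by (simp add: k_def y0_def)
  have k2: "k\<^sup>2 \<ge> 1" using k by (simp add: one_le_power)
  have s: "s \<ge> 0" "s\<^sup>2 = k\<^sup>2 - 1" using k2 by (auto simp: s_def)
  have sk: "s < k" using s(2) k by (intro power2_less_imp_less[of s k]) linarith+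
  have D_iff: "z \<in> D \<longleftrightarrow> Im z > 0 \<and> (Re z - x0)\<^sup>2 \<le> 2 * k * Im z * y0 - (Im z)\<^sup>2 - y0\<^sup>2" for z
  proof (cases "Im z > 0")
    case True
    have "z \<in> D \<longleftrightarrow> 1 + (cmod (A - z))\<^sup>2 / (2 * Im A * Im z) \<le> k"
      using True y0 ImB r hyp_dist_le_iff[of r A B z]
      by (simp add: D_def gdisk_def hyp_plane_def k_def y0_def)
    also have "\<dots> \<longleftrightarrow> (x0 - Re z)\<^sup>2 + (y0 - Im z)\<^sup>2 \<le> (k - 1) * (2 * y0 * Im z)"
      using True y0 by (simp add: cmod_power2 x0_def y0_def[symmetric] field_simps)
    also have "\<dots> \<longleftrightarrow> (Re z - x0)\<^sup>2 \<le> 2 * k * Im z * y0 - (Im z)\<^sup>2 - y0\<^sup>2"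
      by (simp add: power2_eq_square algebra_simps)
    finally show ?thesis using True by simp
  qed (auto simp: D_def gdisk_def hyp_plane_def)
  define f where "f = (\<lambda>z. if z \<in> D then r\<^sup>2 / (Im z)\<^sup>2 else 0)"
  have [measurable]: "D \<in> sets borel"
  proof -
    have "D = {z. 0 < Im z} \<inter> {z. (Re z - x0)\<^sup>2 \<le> 2 * k * Im z * y0 - (Im z)\<^sup>2 - y0\<^sup>2}"
      using D_iff by blast
    also have "\<dots> \<in> sets borel"
      by (intro sets.Int borel_open borel_closed open_Collect_less closed_Collect_le continuous_intros)
    finally show ?thesis .
  qed
  have f_borel [measurable]: "f \<in> borel_measurable borel"
    unfolding f_def by measurable
  \<comment> \<open>This is the chord length times the density. The guard matters:
    \<open>sqrt\<close> is negative on negative numbers, and \<open>g\<close> must be 0 on lines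
    that miss the disk.\<close>
  define g where "g = (\<lambda>y. if y > 0 \<and> 2 * k * y * y0 - y\<^sup>2 - y0\<^sup>2 \<ge> 0
     then r\<^sup>2 / y\<^sup>2 * (2 * sqrt (2 * k * y * y0 - y\<^sup>2 - y0\<^sup>2)) else 0)"
  have g_borel [measurable]: "g \<in> borel_measurable borel"
    unfolding g_def by measurable
  have inner: "(\<integral>\<^sup>+x. f (Complex x y) \<partial>lborel) = ennreal (g y)" for y
  proof (cases "y > 0 \<and> 2 * k * y * y0 - y\<^sup>2 - y0\<^sup>2 \<ge> 0")
    case True
    define R where "R = sqrt (2 * k * y * y0 - y\<^sup>2 - y0\<^sup>2)"
    have R: "R \<ge> 0" "R\<^sup>2 = 2 * k * y * y0 - y\<^sup>2 - y0\<^sup>2" using True by (auto simp: R_def)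
    have "Complex x y \<in> D \<longleftrightarrow> x \<in> {x0 - R..x0 + R}" for x
    proof -
      have "Complex x y \<in> D \<longleftrightarrow> (x - x0)\<^sup>2 \<le> R\<^sup>2" unfolding R(2) D_iff using True by simp
      also have "\<dots> \<longleftrightarrow> \<bar>x - x0\<bar> \<le> \<bar>R\<bar>" by (simp only: abs_le_square_iff)
      finally show ?thesis using R(1) by auto
    qed
    then have "(\<integral>\<^sup>+x. f (Complex x y) \<partial>lborel) = (\<integral>\<^sup>+x. ennreal (r\<^sup>2 / y\<^sup>2) * indicator {x0 - R..x0 + R} x \<partial>lborel)"
      by (intro nn_integral_cong) (simp add: f_def indicator_def)
    also have "\<dots> = ennreal (r\<^sup>2 / y\<^sup>2) * ennreal (2 * R)"
      using R(1) by (subst nn_integral_cmult_indicator) auto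
    also have "\<dots> = ennreal (g y)"
    proof -
      have "g y = r\<^sup>2 / y\<^sup>2 * (2 * R)" using True by (simp add: g_def R_def)
      then show ?thesis using R(1) by (simp only:, intro ennreal_mult[symmetric]) auto
    qed
    finally show ?thesis .
  next
    case False
    have "Complex x y \<notin> D" for x
      using False zero_le_power2[of "x - x0"] unfolding D_iff complex.sel by linarith
    then show ?thesis using False by (auto simp: f_def g_def)
  qed
  \<comment> \<open>The powers of \<open>y0\<close> cancel, as dilations are isometries of the
    half-plane; the form \<open>0 + y0 * w\<close> is that of the affine substitution used
    below.\<close>
  have gw: "y0 * g (0 + y0 * w) = r\<^sup>2 * (indicator {k - s..k + s} w * (2 * sqrt (2 * k * w - w\<^sup>2 - 1) / w\<^sup>2))" for w
  proof -
    have q: "2 * k * (y0 * w) * y0 - (y0 * w)\<^sup>2 - y0\<^sup>2 = y0\<^sup>2 * (2 * k * w - w\<^sup>2 - 1)"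
      by (simp add: power2_eq_square algebra_simps)
    have q2: "2 * k * w - w\<^sup>2 - 1 = s\<^sup>2 - (w - k)\<^sup>2"
      unfolding s(2) by (simp add: power2_eq_square algebra_simps)
    have "w > 0 \<and> 2 * k * w - w\<^sup>2 - 1 \<ge> 0 \<longleftrightarrow> w \<in> {k - s..k + s}"
    proof -
      have "2 * k * w - w\<^sup>2 - 1 \<ge> 0 \<longleftrightarrow> \<bar>w - k\<bar> \<le> \<bar>s\<bar>"
        unfolding q2 by (simp add: abs_le_square_iff)
      then show ?thesis using s(1) sk by auto
    qed
    moreover have "0 < y0 * w \<longleftrightarrow> 0 < w" using y0 by (simp add: zero_less_mult_iff)
    moreover have "0 \<le> y0\<^sup>2 * (2 * k * w - w\<^sup>2 - 1) \<longleftrightarrow> 0 \<le> 2 * k * w - w\<^sup>2 - 1"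
      using y0 by (simp only: zero_le_mult_iff) auto
    ultimately have "g (y0 * w) = (if w \<in> {k - s..k + s} then
        r\<^sup>2 / (y0 * w)\<^sup>2 * (2 * sqrt (y0\<^sup>2 * (2 * k * w - w\<^sup>2 - 1))) else 0)"
      unfolding g_def q by presburger
    then show ?thesis
      using y0 unfolding real_sqrt_mult by (simp add: indicator_def power2_eq_square)
  qed
  have hi: "((\<lambda>w. 2 * sqrt (2 * k * w - w\<^sup>2 - 1) / w\<^sup>2) has_integral 2 * pi * (k - 1)) {k - s..k + s}"
  \<comment> \<open>For radius 0 the interval is a single point; the antiderivative behind the other
    case divides by s and needs s > 0.\<close>
  proof (cases "k = 1")
    case True
    then show ?thesis using has_integral_refl(2)[of _ "1::real"] by (simp add: s_def)
  next
    case False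
    then show ?thesis unfolding s_def using k by (intro has_integral_horocyclic_width) auto
  qed
  have pos: "0 \<le> 2 * sqrt (2 * k * w - w\<^sup>2 - 1) / w\<^sup>2" if "w \<in> {k - s..k + s}" for w
  proof -
    have "\<bar>w - k\<bar> \<le> \<bar>s\<bar>" using that s(1) by auto
    then have "(w - k)\<^sup>2 \<le> s\<^sup>2" by (simp only: abs_le_square_iff)
    then have "0 \<le> 2 * k * w - w\<^sup>2 - 1" unfolding s(2) by (simp add: power2_eq_square algebra_simps)
    then show ?thesis by simp
  qed
  have "(\<integral>\<^sup>+z. f z \<partial>lborel) = (\<integral>\<^sup>+y. ennreal (g y) \<partial>lborel)"
    by (subst nn_integral_complex) (simp_all add: inner)
  also have "\<dots> = (\<integral>\<^sup>+w. ennreal (y0 * g (0 + y0 * w)) \<partial>lborel)"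
    using y0 by (subst nn_integral_real_affine[where c = y0 and t = 0])
      (simp_all add: nn_integral_cmult ennreal_mult')
  also have "\<dots> = (\<integral>\<^sup>+w. ennreal (r\<^sup>2) * ennreal (indicator {k - s..k + s} w * (2 * sqrt (2 * k * w - w\<^sup>2 - 1) / w\<^sup>2)) \<partial>lborel)"
    unfolding gw by (simp only: ennreal_mult'[OF zero_le_power2])
  also have "\<dots> = ennreal (r\<^sup>2) * ennreal (2 * pi * (k - 1))"
    using nn_integral_has_integral_lebesgue[OF pos hi] by (subst nn_integral_cmult) simp_all
  also have "\<dots> = ennreal (2 * pi * r\<^sup>2 * (k - 1))"
    using k by (simp add: ennreal_mult[symmetric] mult_ac)
  finally have "(f has_integral 2 * pi * r\<^sup>2 * (k - 1)) UNIV"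
    using k by (intro nn_integral_has_integral f_borel) (auto simp: f_def)
  then have "((\<lambda>z. r\<^sup>2 / (Im z)\<^sup>2) has_integral 2 * pi * r\<^sup>2 * (k - 1)) D"
    unfolding f_def by (simp only: has_integral_restrict_UNIV)
  then show ?thesis unfolding hyp_area_def D_def[symmetric] k_def by (simp add: integral_unique)
qed

theorem theorem3:
  shows
  "(\<forall>A B D C :: real^2.
      equiangular_quad UNIV dist A B D C \<longrightarrow>
      euc_area (gdisk UNIV dist A (dist A B)) + euc_area (gdisk UNIV dist A (dist A C))
        = euc_area (gdisk UNIV dist A (dist A D)))
   \<and>
   (\<forall>r > 0. \<forall>A B D C :: real^3.
      equiangular_quad (sphere 0 r) (sph_dist r) A B D C \<longrightarrow>
      A \<noteq> - B \<longrightarrow> B \<noteq> - D \<longrightarrow> D \<noteq> - C \<longrightarrow> C \<noteq> - A \<longrightarrow> A \<noteq> - D \<longrightarrow> B \<noteq> - C \<longrightarrow>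
      sph_area r (gdisk (sphere 0 r) (sph_dist r) A (sph_dist r A B))
        + sph_area r (gdisk (sphere 0 r) (sph_dist r) A (sph_dist r A C))
        = sph_area r (gdisk (sphere 0 r) (sph_dist r) A (sph_dist r A D)))
   \<and>
   (\<forall>r > 0. \<forall>A B D C :: complex.
      equiangular_quad hyp_plane (hyp_dist r) A B D C \<longrightarrow>
      hyp_area r (gdisk hyp_plane (hyp_dist r) A (hyp_dist r A B))
        + hyp_area r (gdisk hyp_plane (hyp_dist r) A (hyp_dist r A C))
        = hyp_area r (gdisk hyp_plane (hyp_dist r) A (hyp_dist r A D)))"
proof (intro conjI allI impI)
  fix A B D C :: "real^2"
  assume "equiangular_quad UNIV dist A B D C"
  from pythagoras_equiangular_quad[OF this]
  show "euc_area (gdisk UNIV dist A (dist A B)) + euc_area (gdisk UNIV dist A (dist A C))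
        = euc_area (gdisk UNIV dist A (dist A D))"
    by (simp add: euc_area_disk flip: distrib_left)
next
  fix r :: real and A B D C :: "real^3"
  assume r: "r > 0" and Q: "equiangular_quad (sphere 0 r) (sph_dist r) A B D C"
  then have "A \<in> sphere 0 r" "B \<in> sphere 0 r" "D \<in> sphere 0 r" "C \<in> sphere 0 r"
    by (auto simp: equiangular_quad_def)
  note area = this(2-)[THEN sph_area_disk[OF r this(1)]]
  show "sph_area r (gdisk (sphere 0 r) (sph_dist r) A (sph_dist r A B))
        + sph_area r (gdisk (sphere 0 r) (sph_dist r) A (sph_dist r A C))
        = sph_area r (gdisk (sphere 0 r) (sph_dist r) A (sph_dist r A D))"
    \<comment> \<open>Without the common factor 2 pi, the claim is (r^2 - A \<bullet> B) + (r^2 - A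
      \<bullet> C) = r^2 - A \<bullet> D.\<close>
    unfolding area distrib_left[symmetric] using sph_inner_equiangular_quad[OF r Q] by simp
next
  fix r :: real and A B D C :: complex
  assume r: "r > 0" and Q: "equiangular_quad hyp_plane (hyp_dist r) A B D C"
  then have P: "A \<in> hyp_plane" "B \<in> hyp_plane" "D \<in> hyp_plane" "C \<in> hyp_plane"
    by (auto simp: equiangular_quad_def)
  have area: "hyp_area r (gdisk hyp_plane (hyp_dist r) A (hyp_dist r A X)) = 2 * pi * r\<^sup>2 * (hyp_form A X - 1)"
    if "X \<in> hyp_plane" for X
    using hyp_area_disk[OF r P(1) that] hyp_form_eq[of A X] P(1) that by (simp add: hyp_plane_def)
  show "hyp_area r (gdisk hyp_plane (hyp_dist r) A (hyp_dist r A B))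
        + hyp_area r (gdisk hyp_plane (hyp_dist r) A (hyp_dist r A C))
        = hyp_area r (gdisk hyp_plane (hyp_dist r) A (hyp_dist r A D))"
    unfolding area[OF P(2)] area[OF P(3)] area[OF P(4)] distrib_left[symmetric]
    using hyp_form_equiangular_quad[OF r Q] by simp
qed

end
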